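(* For every fixed $d\ge2$ there is a constant $c_d>0$ such that for infinitely many values of $n$ there is an $n$-point set $P\subset[0,1]^d$ with \[ \operatorname{disc}_{2,\overline{w}}\mathcal{A}_d(P)\ge c_d\log^{d-1}n . \]
   Context: For $x\in[0,1]^d$ let $A(x)=[0,x_1]\times\cdots\times[0,x_d]$. For a finite $P\subset[0,1]^d$, $\mathcal{A}_d(P)=\{A(x)\cap P: x\in[0,1]^d\}$ (the set system on $P$ induced by anchored boxes), and $\overline{w}:\mathcal{A}_d(P)\to[0,1]$ is the weight $\overline{w}(F)=\lambda^d\{x\in[0,1]^d: A(x)\cap P=F\}$, where $\lambda^d$ is Lebesgue measure. For a set system $\mathcal{F}$ on a ground set $V$ and a nonnegative weight $w:\mathcal{F}\to[0,\infty)$ not identically zero, $\operatorname{disc}_{p,w}\mathcal{F}=\min_{x\in\{-1,1\}^V}\bigl(\frac{1}{w(\mathcal{F})}\sum_{F\in\mathcal{F}}w(F)|x(F)|^p\bigr)^{1/p}$, where $x(F)=\sum_{v\in F}x_v$ and $w(\mathcal{F})=\sum_{F\in\mathcal{F}}w(F)$. *)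

theory Defs
  imports "HOL-Analysis.Analysis"
begin

definition anchored_box :: "real^'n \<Rightarrow> (real^'n) set" where
  "anchored_box x = cbox 0 x"

definition anchored_boxes :: "(real^'n) set \<Rightarrow> (real^'n) set set" where
  "anchored_boxes P = {anchored_box x \<inter> P | x. x \<in> cbox 0 One}"

definition anchored_weight :: "(real^'n) set \<Rightarrow> (real^'n) set \<Rightarrow> real" where
  "anchored_weight P F = measure lebesgue {x \<in> cbox 0 One. anchored_box x \<inter> P = F}"

definition disc :: "real \<Rightarrow> ('a set \<Rightarrow> real) \<Rightarrow> 'a set \<Rightarrow> 'a set set \<Rightarrow> real" where
  "disc p w V \<F> = Min ((\<lambda>x. ((1 / (\<Sum>F\<in>\<F>. w F)) *
        (\<Sum>F\<in>\<F>. w F * \<bar>\<Sum>v\<in>F. x v\<bar> powr p)) powr (1 / p))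
      ` (PiE V (\<lambda>_. {-1, 1::real})))"

end

theory Submission
  imports Defs
begin

text \<open>
  For a signing \<open>x\<close> of \<open>P\<close>, the square of the \<open>L\<^sub>2\<close> average is
  \<open>\<integral> (\<Sum>p\<in>P. x p * [p \<le> y])\<^sup>2 dy\<close> over the unit cube. The kernel \<open>[p \<le> y]\<close> has the product sines
  and cosines of frequencies \<open>(k\<^sub>i - 1/2) \<pi>\<close> as singular functions, with singular values
  \<open>\<Prod>i. 1 / ((k\<^sub>i - 1/2) \<pi>)\<close>. About \<open>N = K log\<^sup>d\<^sup>-\<^sup>1 K\<close> of these are at least \<open>c / K\<close> (hyperbolic cross).
  Averaging over the location of the next point, a greedy Gram--Schmidt selection finds \<open>N / 2\<close>
  points each at squared distance at least of order \<open>N / K\<^sup>2\<close> from the span of its predecessors. A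
  counting form of the determinant lower bound for hereditary discrepancy then yields a subset of
  these points all of whose signings have squared norm of order \<open>(N / K)\<^sup>2\<close>.
\<close>

subsection \<open>Bessel's inequality and greedy selection\<close>

text \<open>Vectors of \<open>R^H\<close> are encoded as total functions whose values outside
  \<open>H\<close> are ignored; two of them need only agree on \<open>H\<close> to be
  interchangeable.\<close>

definition inner_on :: "'k set \<Rightarrow> ('k \<Rightarrow> real) \<Rightarrow> ('k \<Rightarrow> real) \<Rightarrow> real" where
  "inner_on H u v = (\<Sum>k\<in>H. u k * v k)"

lemma inner_on_commute: "inner_on H u v = inner_on H v u"
  by (simp add: inner_on_def mult.commute)

lemma inner_on_diff_left: "inner_on H (\<lambda>k. u k - v k) w = inner_on H u w - inner_on H v w"
  by (simp add: inner_on_def sum_subtractf left_diff_distrib)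

lemma inner_on_scale_left: "inner_on H (\<lambda>k. c * u k) w = c * inner_on H u w"
  by (simp add: inner_on_def sum_distrib_left mult.assoc)

lemma inner_on_sum_left: "inner_on H (\<lambda>k. \<Sum>j\<in>J. u j k) w = (\<Sum>j\<in>J. inner_on H (u j) w)"
  unfolding inner_on_def sum_distrib_right by (rule sum.swap)

lemma inner_on_cong_left: "(\<And>k. k \<in> H \<Longrightarrow> u k = v k) \<Longrightarrow> inner_on H u w = inner_on H v w"
  by (simp add: inner_on_def)

lemma inner_on_combination_left:
  "inner_on H (\<lambda>k. \<Sum>j\<in>J. c j * u j k) w = (\<Sum>j\<in>J. c j * inner_on H (u j) w)"
  by (simp add: inner_on_sum_left inner_on_scale_left)

text \<open>Integrating the square of the residual \<open>F - (sum of c k * u k)\<close> gives a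
  nonnegative number, and orthonormality collapses it to the difference of the two sides. The
  measure is arbitrary, so that the result serves both for \<open>R^H\<close> and for functions on
  the cube.\<close>

lemma Bessel_integral:
  fixes u :: "'k \<Rightarrow> 'a \<Rightarrow> real"
  assumes H: "finite H"
    and F: "integrable M (\<lambda>x. F x * F x)"
    and Fu: "\<And>k. k \<in> H \<Longrightarrow> integrable M (\<lambda>x. F x * u k x)"
    and uu: "\<And>k l. k \<in> H \<Longrightarrow> l \<in> H \<Longrightarrow> integrable M (\<lambda>x. u k x * u l x)"
    and orth: "\<And>k l. k \<in> H \<Longrightarrow> l \<in> H \<Longrightarrow> (\<integral>x. u k x * u l x \<partial>M) = (if k = l then 1 else 0)"
  shows "(\<Sum>k\<in>H. (\<integral>x. F x * u k x \<partial>M)\<^sup>2) \<le> (\<integral>x. F x * F x \<partial>M)"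
proof -
  define c where "c k = (\<integral>x. F x * u k x \<partial>M)" for k
  have sq: "(F x - (\<Sum>k\<in>H. c k * u k x))\<^sup>2 = F x * F x - 2 * (\<Sum>k\<in>H. c k * (F x * u k x))
     + (\<Sum>k\<in>H. \<Sum>l\<in>H. c k * c l * (u k x * u l x))" for x
    by (simp add: power2_eq_square algebra_simps sum_distrib_left sum_distrib_right)
  have I1: "integrable M (\<lambda>x. 2 * (\<Sum>k\<in>H. c k * (F x * u k x)))"
    using Fu by (intro integrable_mult_right Bochner_Integration.integrable_sum) auto
  have I2: "integrable M (\<lambda>x. \<Sum>k\<in>H. \<Sum>l\<in>H. c k * c l * (u k x * u l x))"
    using uu by (intro integrable_mult_right Bochner_Integration.integrable_sum) auto
  have "0 \<le> (\<integral>x. (F x - (\<Sum>k\<in>H. c k * u k x))\<^sup>2 \<partial>M)" by simp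
  also have "\<dots> = (\<integral>x. F x * F x \<partial>M) - (\<integral>x. 2 * (\<Sum>k\<in>H. c k * (F x * u k x)) \<partial>M)
     + (\<integral>x. (\<Sum>k\<in>H. \<Sum>l\<in>H. c k * c l * (u k x * u l x)) \<partial>M)"
    unfolding sq using F I1 I2 by simp
  also have "(\<integral>x. 2 * (\<Sum>k\<in>H. c k * (F x * u k x)) \<partial>M) = 2 * (\<Sum>k\<in>H. c k * c k)"
    using Fu by (simp add: Bochner_Integration.integral_sum c_def)
  also have "(\<integral>x. (\<Sum>k\<in>H. \<Sum>l\<in>H. c k * c l * (u k x * u l x)) \<partial>M)
      = (\<Sum>k\<in>H. \<Sum>l\<in>H. c k * c l * (if k = l then 1 else 0))"
    using uu by (subst Bochner_Integration.integral_sum, force)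
      (intro sum.cong refl, subst Bochner_Integration.integral_sum, auto simp: orth)
  also have "\<dots> = (\<Sum>k\<in>H. c k * c k)"
    using H by (simp add: if_distrib cong: if_cong)
  finally show ?thesis by (simp add: c_def power2_eq_square)
qed

text \<open>The counting measure on \<open>H\<close> turns the integrals into finite sums.\<close>

lemma Bessel_inner_on:
  assumes H: "finite H"
    and orth: "\<And>i j. i \<in> J \<Longrightarrow> j \<in> J \<Longrightarrow> inner_on H (g i) (g j) = (if i = j then 1 else 0)"
    and J: "finite J"
  shows "(\<Sum>i\<in>J. (inner_on H v (g i))\<^sup>2) \<le> inner_on H v v"
  using Bessel_integral[of J "count_space H" v g] assms
  by (simp add: inner_on_def lebesgue_integral_count_space_finite integrable_count_space)

text \<open>The second moment of \<phi> is \<mu> times the identity, so each of the \<open>m\<close>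
  directions already chosen captures mean square \<mu> out of a total \<open>\<mu> * card H\<close>.
  While \<open>m\<close> is below half of \<open>card H\<close>, the mean squared residual exceeds
  half the total, and some point does at least as well as half the total; its normalised residual is
  the next direction. The outcome is a triangular matrix of coefficients with a large diagonal. The
  last conjunct is an invariant of the induction: the chosen vectors stay in the span of the
  directions.\<close>

lemma greedy_orthonormal_selection:
  fixes \<phi> :: "'p \<Rightarrow> 'k \<Rightarrow> real" and m :: nat
  assumes "finite_measure M" and prob: "measure M (space M) = 1" and H: "finite H"
    and int: "\<And>k l. k \<in> H \<Longrightarrow> l \<in> H \<Longrightarrow> integrable M (\<lambda>p. \<phi> p k * \<phi> p l)"
    and orth: "\<And>k l. k \<in> H \<Longrightarrow> l \<in> H \<Longrightarrow> (\<integral>p. \<phi> p k * \<phi> p l \<partial>M) = (if k = l then \<mu> else 0)"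
    and lam: "\<mu> > 0" and m: "2 * m \<le> card H"
  shows "\<exists>p g. (\<forall>i<m. p i \<in> space M) \<and>
    (\<forall>i<m. \<forall>j<m. inner_on H (g i) (g j) = (if i = j then 1 else 0)) \<and>
    (\<forall>i<m. \<forall>j<i. inner_on H (\<phi> (p j)) (g i) = 0) \<and>
    (\<forall>i<m. (inner_on H (\<phi> (p i)) (g i))\<^sup>2 \<ge> \<mu> * card H / 2) \<and>
    (\<forall>j<m. \<forall>k\<in>H. \<phi> (p j) k = (\<Sum>i<m. inner_on H (\<phi> (p j)) (g i) * g i k))"
  using m
proof (induction m)
  case 0
  then show ?case by simp
next
  case (Suc m)
  interpret finite_measure M by fact
  have "2 * m \<le> card H" using Suc.prems by simp
  from Suc.IH[OF this] obtain p g where IH: "\<forall>i<m. p i \<in> space M"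
    "\<forall>i<m. \<forall>j<m. inner_on H (g i) (g j) = (if i = j then 1 else 0)"
    "\<forall>i<m. \<forall>j<i. inner_on H (\<phi> (p j)) (g i) = 0"
    "\<forall>i<m. (inner_on H (\<phi> (p i)) (g i))\<^sup>2 \<ge> \<mu> * card H / 2"
    "\<forall>j<m. \<forall>k\<in>H. \<phi> (p j) k = (\<Sum>i<m. inner_on H (\<phi> (p j)) (g i) * g i k)"
    by (elim exE conjE)
  note p = IH(1)[rule_format] and g = IH(2)[rule_format] and tri = IH(3)[rule_format]
    and diag = IH(4)[rule_format] and span = IH(5)[rule_format]
  \<comment> \<open>\<open>r q\<close> is the component of \<open>\<phi> q\<close> orthogonal to the
    directions chosen so far.\<close>
  define r where "r q k = \<phi> q k - (\<Sum>j<m. inner_on H (\<phi> q) (g j) * g j k)" for q k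
  have r_g: "inner_on H (r q) (g j) = 0" if "j < m" for q j
  proof -
    have "(\<Sum>i<m. inner_on H (\<phi> q) (g i) * inner_on H (g i) (g j))
      = (\<Sum>i<m. if i = j then inner_on H (\<phi> q) (g j) else 0)"
      using that by (intro sum.cong) (auto simp: g)
    then show ?thesis
      using that by (simp add: r_def[abs_def] inner_on_diff_left inner_on_combination_left)
  qed
  have phi_r: "inner_on H (\<phi> q) (r q) = inner_on H (\<phi> q) (\<phi> q) - (\<Sum>j<m. (inner_on H (\<phi> q) (g j))\<^sup>2)" for q
  proof -
    have "inner_on H (r q) (\<phi> q)
      = inner_on H (\<phi> q) (\<phi> q) - (\<Sum>j<m. inner_on H (\<phi> q) (g j) * inner_on H (g j) (\<phi> q))"
      by (simp add: r_def[abs_def] inner_on_diff_left inner_on_combination_left)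
    then show ?thesis by (simp add: power2_eq_square inner_on_commute)
  qed
  have rr: "inner_on H (r q) (r q) = inner_on H (\<phi> q) (r q)" for q
  proof -
    have "inner_on H (r q) (r q) = inner_on H (\<phi> q) (r q) - (\<Sum>j<m. inner_on H (\<phi> q) (g j) * inner_on H (g j) (r q))"
      by (subst r_def[abs_def]) (simp add: inner_on_diff_left inner_on_combination_left)
    then show ?thesis using r_g by (simp add: inner_on_commute)
  qed
  have sq: "(inner_on H (\<phi> q) v)\<^sup>2 = (\<Sum>k\<in>H. \<Sum>l\<in>H. v k * v l * (\<phi> q k * \<phi> q l))" for q v
    by (simp add: inner_on_def power2_eq_square sum_product algebra_simps)
  have sq_int: "integrable M (\<lambda>q. (inner_on H (\<phi> q) v)\<^sup>2)" for v
    unfolding sq using int by (intro Bochner_Integration.integrable_sum integrable_mult_right) auto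
  \<comment> \<open>Isotropy: the mean squared coefficient along \<open>v\<close> depends on
    \<open>v\<close> only through its norm.\<close>
  have sq_val: "(\<integral>q. (inner_on H (\<phi> q) v)\<^sup>2 \<partial>M) = \<mu> * inner_on H v v" for v
  proof -
    have "(\<integral>q. (inner_on H (\<phi> q) v)\<^sup>2 \<partial>M) = (\<Sum>k\<in>H. \<Sum>l\<in>H. v k * v l * (if k = l then \<mu> else 0))"
      unfolding sq using int by (subst Bochner_Integration.integral_sum, force)
      (intro sum.cong refl, subst Bochner_Integration.integral_sum, auto simp: orth)
    also have "\<dots> = (\<Sum>k\<in>H. v k * v k * \<mu>)"
      using H by (simp add: if_distrib cong: if_cong)
    finally show ?thesis by (simp add: inner_on_def sum_distrib_left mult.commute)
  qed
  have pp_int: "integrable M (\<lambda>q. inner_on H (\<phi> q) (\<phi> q))"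
    unfolding inner_on_def using int by (intro Bochner_Integration.integrable_sum) auto
  have pp_val: "(\<integral>q. inner_on H (\<phi> q) (\<phi> q) \<partial>M) = \<mu> * card H"
    unfolding inner_on_def using int by (simp add: Bochner_Integration.integral_sum orth)
  have rr_int: "integrable M (\<lambda>q. inner_on H (r q) (r q))"
    unfolding rr phi_r using pp_int sq_int
    by (intro Bochner_Integration.integrable_diff Bochner_Integration.integrable_sum) auto
  have rr_val: "(\<integral>q. inner_on H (r q) (r q) \<partial>M) = \<mu> * (card H - real m)"
    unfolding rr phi_r using pp_int sq_int
    by (simp add: Bochner_Integration.integral_sum pp_val sq_val g algebra_simps)
  have "\<exists>q\<in>space M. inner_on H (r q) (r q) \<ge> \<mu> * card H / 2"
  proof (rule ccontr)
    assume "\<not> ?thesis"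
    then have "(\<integral>q. inner_on H (r q) (r q) \<partial>M) \<le> (\<integral>q. \<mu> * card H / 2 \<partial>M)"
      using rr_int by (intro integral_mono) (auto simp: not_le intro: less_imp_le)
    also have "\<dots> = \<mu> * (card H / 2)" using prob by simp
    also have "\<dots> < \<mu> * (card H - real m)"
      using Suc.prems lam by (intro mult_strict_left_mono) auto
    finally show False using rr_val by simp
  qed
  then obtain q where q: "q \<in> space M" "inner_on H (r q) (r q) \<ge> \<mu> * card H / 2" by blast
  define n where "n = sqrt (inner_on H (r q) (r q))"
  have "\<mu> * card H / 2 > 0" using lam Suc.prems by simp
  then have pos: "inner_on H (r q) (r q) > 0" using q by linarith
  then have n: "n > 0" "n * n = inner_on H (r q) (r q)" by (auto simp: n_def)
  define h where "h = (\<lambda>k. (1 / n) * r q k)"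
  have h_left: "inner_on H h v = inner_on H (r q) v / n" for v
    unfolding h_def inner_on_scale_left by simp
  have h_right: "inner_on H v h = inner_on H v (r q) / n" for v
    using h_left[of v] by (simp add: inner_on_commute)
  have hh: "inner_on H h h = 1" using n pos by (simp add: h_left h_right field_simps)
  have h_g: "inner_on H h (g j) = 0" if "j < m" for j using that r_g by (simp add: h_left)
  have h_g': "inner_on H (g j) h = 0" if "j < m" for j using that h_g inner_on_commute by metis
  have phi_h: "inner_on H (\<phi> q) h = n" using n rr[of q] by (simp add: h_right field_simps)
  \<comment> \<open>The span invariant enters here: an earlier vector is a combination of old
    directions, all orthogonal to \<open>h\<close>.\<close>
  have old_h: "inner_on H (\<phi> (p j)) h = 0" if "j < m" for j
  proof -
    have "inner_on H (\<phi> (p j)) h = inner_on H (\<lambda>k. \<Sum>i<m. inner_on H (\<phi> (p j)) (g i) * g i k) h"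
      using span[OF that] by (rule inner_on_cong_left)
    also have "\<dots> = 0" by (simp add: inner_on_combination_left h_g')
    finally show ?thesis .
  qed
  have phi_q: "\<phi> q k = (\<Sum>i<m. inner_on H (\<phi> q) (g i) * g i k) + n * h k" for k
    using n by (simp add: h_def r_def)
  show ?case
  proof (intro exI[of _ "p(m := q)"] exI[of _ "g(m := h)"] conjI allI impI ballI)
    fix i assume "i < Suc m" then show "(p(m := q)) i \<in> space M" using p q by (auto simp: less_Suc_eq)
  next
    fix i j assume "i < Suc m" "j < Suc m"
    then show "inner_on H ((g(m := h)) i) ((g(m := h)) j) = (if i = j then 1 else 0)"
      using g hh h_g h_g' by (auto simp: less_Suc_eq)
  next
    fix i j assume "i < Suc m" "j < i"
    then show "inner_on H (\<phi> ((p(m := q)) j)) ((g(m := h)) i) = 0"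
      using tri old_h by (auto simp: less_Suc_eq)
  next
    fix i assume "i < Suc m"
    then show "\<mu> * card H / 2 \<le> (inner_on H (\<phi> ((p(m := q)) i)) ((g(m := h)) i))\<^sup>2"
      using diag q n phi_h by (auto simp: less_Suc_eq power2_eq_square)
  next
    fix j k assume "j < Suc m" "k \<in> H"
    then show "\<phi> ((p(m := q)) j) k = (\<Sum>i<Suc m. inner_on H (\<phi> ((p(m := q)) j)) ((g(m := h)) i) * (g(m := h)) i k)"
      using span phi_q phi_h old_h by (auto simp: less_Suc_eq)
  qed
qed

subsection \<open>Hereditary discrepancy of triangular matrices\<close>

text \<open>Either \<open>c\<close> itself or both of \<open>c - r\<close> and \<open>c + r\<close>
  are at distance at least \<open>\<bar>r\<bar> / 2\<close> from zero. With weights 2, 1, 1 the far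
  points carry at least half of the total weight 4 in either case.\<close>

lemma three_point_exp_sum_le:
  fixes c r s d :: real
  assumes "r\<^sup>2 \<ge> d\<^sup>2" "s \<ge> 0"
  shows "(\<Sum>t\<in>{-1,0,1}. (if t = 0 then 2 else 1) * exp (- s * (c + r * t)\<^sup>2))
           \<le> 2 * (1 + exp (- s * d\<^sup>2 / 4))"
proof -
  define e where "e = exp (- s * d\<^sup>2 / 4)"
  define h where "h y = exp (- s * y\<^sup>2)" for y
  have le1: "h y \<le> 1" for y using assms by (simp add: h_def)
  have small: "h y \<le> e" if "y\<^sup>2 \<ge> r\<^sup>2 / 4" for y
  proof -
    have "s * y\<^sup>2 \<ge> s * (d\<^sup>2 / 4)" using that assms by (intro mult_left_mono) auto
    then show ?thesis by (simp add: h_def e_def)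
  qed
  have "2 * h c + h (c - r) + h (c + r) \<le> 2 * (1 + e)"
  proof (cases "c\<^sup>2 \<ge> r\<^sup>2 / 4")
    case True
    show ?thesis using small[OF True] le1[of "c - r"] le1[of "c + r"] by simp
  next
    case False
    have quarter: "(r / 2)\<^sup>2 = r\<^sup>2 / 4" by (simp add: power_divide)
    from False have "\<not> \<bar>r / 2\<bar> \<le> \<bar>c\<bar>"
      unfolding abs_le_square_iff quarter .
    then have "\<bar>r / 2\<bar> \<le> \<bar>c - r\<bar>" "\<bar>r / 2\<bar> \<le> \<bar>c + r\<bar>" by arith+
    then have far: "(c - r)\<^sup>2 \<ge> r\<^sup>2 / 4" "(c + r)\<^sup>2 \<ge> r\<^sup>2 / 4"
      unfolding abs_le_square_iff quarter by auto
    show ?thesis using small[OF far(1)] small[OF far(2)] le1[of c] by simp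
  qed
  then show ?thesis by (simp add: h_def e_def)
qed

text \<open>Coordinates are summed out from the first on. Row \<open>i\<close> only involves
  coordinates from \<open>i\<close> on, so \<open>z a\<close> occurs in row \<open>a\<close> alone;
  with the later coordinates fixed, the sum over \<open>z a\<close> is a three-point sum with step
  \<open>R a a\<close> and contributes one factor of the bound.\<close>

lemma triangular_exp_sum_le:
  fixes R :: "nat \<Rightarrow> nat \<Rightarrow> real" and s d :: real
  assumes diag: "\<And>i. i < m \<Longrightarrow> (R i i)\<^sup>2 \<ge> d\<^sup>2" and s: "s \<ge> 0" and a: "a \<le> m"
  shows "(\<Sum>z\<in>PiE {a..<m} (\<lambda>_. {-1,0,1}). \<Prod>i\<in>{a..<m}.
            (if z i = 0 then 2 else 1) * exp (- s * (\<Sum>j\<in>{i..<m}. R i j * z j)\<^sup>2))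
          \<le> (2 * (1 + exp (- s * d\<^sup>2 / 4))) ^ (m - a)"
  using a
proof (induction "m - a" arbitrary: a)
  case 0
  then have "{a..<m} = {}" "m - a = 0" by auto
  then show ?case by (simp only: PiE_empty_domain prod.empty power_0) simp
next
  case (Suc n)
  have am: "a < m" using Suc.hyps(2) by simp
  let ?f = "\<lambda>z i. (if z i = 0 then 2 else 1) * exp (- s * (\<Sum>j\<in>{i..<m}. R i j * z j)\<^sup>2)"
  let ?B = "2 * (1 + exp (- s * d\<^sup>2 / 4))"
  let ?Z = "PiE {Suc a..<m} (\<lambda>_. {-1,0,1::real})"
  have ins: "{a..<m} = insert a {Suc a..<m}" using am by auto
  have prod: "(\<Prod>i\<in>{a..<m}. ?f (z(a := t)) i) =
     (\<Prod>i\<in>{Suc a..<m}. ?f z i) * ((if t = 0 then 2 else 1) * exp (- s * ((\<Sum>j\<in>{Suc a..<m}. R a j * z j) + R a a * t)\<^sup>2))"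
    for z t
  proof -
    have "(\<Prod>i\<in>{Suc a..<m}. ?f (z(a := t)) i) = (\<Prod>i\<in>{Suc a..<m}. ?f z i)"
      by (intro prod.cong refl arg_cong2[where f = times] arg_cong[where f = exp] arg_cong2[where f = power] sum.cong) auto
    moreover have "(\<Sum>j\<in>{a..<m}. R a j * (z(a := t)) j) = (\<Sum>j\<in>{Suc a..<m}. R a j * z j) + R a a * t"
      unfolding ins by (subst sum.insert) (auto intro!: sum.cong)
    ultimately show ?thesis
      by (subst ins, subst prod.insert) (auto simp: algebra_simps)
  qed
  have "(\<Sum>z\<in>PiE {a..<m} (\<lambda>_. {-1,0,1}). \<Prod>i\<in>{a..<m}. ?f z i)
     = (\<Sum>(t,z)\<in>{-1,0,1} \<times> ?Z. \<Prod>i\<in>{a..<m}. ?f (z(a := t)) i)"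
    unfolding ins PiE_insert_eq
    by (subst sum.reindex[OF inj_combinator]) (simp_all add: case_prod_unfold)
  also have "\<dots> = (\<Sum>z\<in>?Z. \<Sum>t\<in>{-1,0,1}. \<Prod>i\<in>{a..<m}. ?f (z(a := t)) i)"
    by (subst sum.cartesian_product[symmetric]) (rule sum.swap)
  also have "\<dots> = (\<Sum>z\<in>?Z. (\<Prod>i\<in>{Suc a..<m}. ?f z i) *
      (\<Sum>t\<in>{-1,0,1}. (if t = 0 then 2 else 1) * exp (- s * ((\<Sum>j\<in>{Suc a..<m}. R a j * z j) + R a a * t)\<^sup>2)))"
    unfolding prod sum_distrib_left ..
  also have "\<dots> \<le> (\<Sum>z\<in>?Z. (\<Prod>i\<in>{Suc a..<m}. ?f z i) * ?B)"
    using am diag[of a] s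
    by (intro sum_mono mult_left_mono three_point_exp_sum_le prod_nonneg) simp_all
  also have "\<dots> = (\<Sum>z\<in>?Z. (\<Prod>i\<in>{Suc a..<m}. ?f z i)) * ?B"
    by (simp add: sum_distrib_right)
  also have "\<dots> \<le> ?B ^ (m - Suc a) * ?B"
    using Suc.hyps(1)[of "Suc a"] Suc.hyps(2) am by (intro mult_right_mono) simp_all
  also have "\<dots> = ?B ^ (m - a)"
    using am by (subst power_Suc2[symmetric]) (simp add: Suc_diff_Suc)
  finally show ?case .
qed

text \<open>
  If every subset admitted a good signing, then the \<open>3 ^ m\<close> points of \<open>{0, 1/2, 1} ^ m\<close> could be
  rounded to the \<open>2 ^ m\<close> vertices of the cube with small error; a triangular matrix with large
  diagonal separates the points too well for that. A point rounded to a vertex is encoded by twice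
  the rounding error, a vector over \<open>{-1, 0, 1}\<close>, and each zero of it leaves two choices for the
  vertex: this is the weight \<open>2\<close> attached to zeros.
\<close>

lemma triangular_hereditary_discrepancy:
  fixes R :: "nat \<Rightarrow> nat \<Rightarrow> real" and d :: real
  assumes diag: "\<And>i. i < m \<Longrightarrow> (R i i)\<^sup>2 \<ge> d\<^sup>2"
    and tri: "\<And>i j. i < m \<Longrightarrow> j < i \<Longrightarrow> R i j = 0"
    and d: "d > 0" and m: "m > 0"
  shows "\<exists>S\<subseteq>{..<m}. \<forall>x. (\<forall>j. x j \<in> {-1, 1::real}) \<longrightarrow>
           (\<Sum>i<m. (\<Sum>j\<in>S. R i j * x j)\<^sup>2) \<ge> m * d\<^sup>2 / 80"
proof (rule ccontr)
  assume "\<not> ?thesis"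
  then have "\<forall>S. \<exists>x. S \<subseteq> {..<m} \<longrightarrow> (\<forall>j. x j \<in> {-1, 1::real}) \<and> (\<Sum>i<m. (\<Sum>j\<in>S. R i j * x j)\<^sup>2) < m * d\<^sup>2 / 80"
    by (meson not_le)
  from choice[OF this] obtain x where x: "\<And>S j. S \<subseteq> {..<m} \<Longrightarrow> x S j \<in> {-1, 1::real}"
    and small: "\<And>S. S \<subseteq> {..<m} \<Longrightarrow> (\<Sum>i<m. (\<Sum>j\<in>S. R i j * x S j)\<^sup>2) < m * d\<^sup>2 / 80"
    by blast
  \<comment> \<open>This value makes the separation exponent \<open>s * d^2 / 4\<close> equal to 2
    and the total rounding loss \<open>s * m * d^2 / 80\<close> equal to \<open>m / 10\<close>. The
    contradiction is then that \<open>3 * exp (-1/10)\<close> exceeds 5/2, while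
    \<open>2 * (1 + exp (-2))\<close> is at most 5/2.\<close>
  define s where "s = 8 / d\<^sup>2"
  have s: "s > 0" using d by (simp add: s_def)
  define z where "z S = (\<lambda>j\<in>{0..<m}. if j \<in> S then x S j else 0)" for S
  define W where "W = (\<lambda>z. \<Prod>i\<in>{0..<m}. (if z i = 0 then 2 else 1) * exp (- s * (\<Sum>j\<in>{i..<m}. R i j * z j)\<^sup>2))"
  have z_zero: "z S j = 0 \<longleftrightarrow> j \<notin> S" if "S \<subseteq> {..<m}" "j < m" for S j
    using x[OF that(1), of j] that by (auto simp: z_def)
  \<comment> \<open>\<open>S\<close> is recovered from \<open>z S\<close> as its support.\<close>
  have inj: "inj_on z (Pow {..<m})"
  proof (rule inj_onI)
    fix S T assume *: "S \<in> Pow {..<m}" "T \<in> Pow {..<m}" "z S = z T"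
    have "j \<in> S \<longleftrightarrow> j \<in> T" if "j < m" for j
      using z_zero[of S j] z_zero[of T j] * that by auto
    then show "S = T" using * by blast
  qed
  have mem: "z ` Pow {..<m} \<subseteq> PiE {0..<m} (\<lambda>_. {-1,0,1})"
  proof (intro image_subsetI PiE_I)
    fix S j assume "S \<in> Pow {..<m}" "j \<in> {0..<m}"
    then show "z S j \<in> {-1,0,1}" using x[of S j] by (auto simp: z_def)
  qed (simp add: z_def)
  have W_ge: "W (z S) \<ge> 2 ^ card ({..<m} - S) * exp (- (real m / 10))" if S: "S \<subseteq> {..<m}" for S
  proof -
    \<comment> \<open>Below the diagonal \<open>R\<close> vanishes, so the truncated row sum of
      \<open>z S\<close> is the full signed sum over \<open>S\<close>.\<close>
    have row: "(\<Sum>j\<in>{i..<m}. R i j * z S j) = (\<Sum>j\<in>S. R i j * x S j)" if "i < m" for i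
    proof -
      have "(\<Sum>j\<in>{i..<m}. R i j * z S j) = (\<Sum>j\<in>{..<m}. R i j * z S j)"
        using tri[OF that] by (intro sum.mono_neutral_left) (auto simp: not_le)
      also have "\<dots> = (\<Sum>j\<in>{..<m}. if j \<in> S then R i j * x S j else 0)"
        by (intro sum.cong) (auto simp: z_def)
      also have "\<dots> = (\<Sum>j\<in>S. R i j * x S j)"
        using S by (simp add: sum.If_cases Int_absorb1)
      finally show ?thesis .
    qed
    have "(\<Prod>i\<in>{0..<m}. if z S i = 0 then 2 else (1::real)) = (\<Prod>i\<in>{..<m}. if i \<notin> S then 2 else 1)"
      using z_zero[OF S] by (intro prod.cong) auto
    also have "\<dots> = 2 ^ card ({..<m} - S)"
      by (simp add: prod.If_cases Diff_eq Compl_eq)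
    finally have p: "(\<Prod>i\<in>{0..<m}. if z S i = 0 then 2 else (1::real)) = 2 ^ card ({..<m} - S)" .
    have "(\<Prod>i\<in>{0..<m}. exp (- s * (\<Sum>j\<in>{i..<m}. R i j * z S j)\<^sup>2))
       = exp (- s * (\<Sum>i<m. (\<Sum>j\<in>S. R i j * x S j)\<^sup>2))"
      by (simp add: exp_sum[symmetric] row sum_distrib_left sum_negf lessThan_atLeast0)
    also have "\<dots> \<ge> exp (- s * (m * d\<^sup>2 / 80))"
      using small[OF S] s by (simp add: mult_left_mono)
    also have "- s * (m * d\<^sup>2 / 80) = - (real m / 10)"
      using d by (simp add: s_def field_simps)
    finally show ?thesis unfolding W_def prod.distrib p by simp
  qed
  \<comment> \<open>Expanding \<open>(1 + 2) ^ m\<close> over subsets: a set \<open>S\<close> is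
    counted once for each choice on its complement.\<close>
  have "3 ^ m * exp (- (real m / 10)) = (\<Sum>S\<in>Pow {..<m}. 2 ^ card ({..<m} - S) * exp (- (real m / 10)))"
    using prod_add[of "{..<m}" "\<lambda>_. 1::real" "\<lambda>_. 2"] by (simp add: sum_distrib_right)
  also have "\<dots> \<le> (\<Sum>S\<in>Pow {..<m}. W (z S))"
    using W_ge by (intro sum_mono) auto
  also have "\<dots> = (\<Sum>z\<in>z ` Pow {..<m}. W z)"
    using inj by (simp add: sum.reindex)
  also have "\<dots> \<le> (\<Sum>z\<in>PiE {0..<m} (\<lambda>_. {-1,0,1}). W z)"
    using mem by (intro sum_mono2) (auto intro!: finite_PiE prod_nonneg simp: W_def)
  also have "\<dots> \<le> (2 * (1 + exp (- s * d\<^sup>2 / 4))) ^ m"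
    unfolding W_def using triangular_exp_sum_le[where m = m and R = R and d = d and s = s and a = 0] diag s by simp
  also have "- s * d\<^sup>2 / 4 = - 2" using d by (simp add: s_def)
  also have "(2 * (1 + exp (- 2::real))) ^ m \<le> (5 / 2) ^ m"
  proof (rule power_mono)
    have "exp (2::real) = exp 1 * exp 1" by (simp add: exp_add[symmetric])
    moreover have "exp 1 \<ge> (2::real)" using exp_ge_add_one_self[of 1] by simp
    ultimately have "exp (2::real) \<ge> 4" using mult_mono[of 2 "exp 1" 2 "exp (1::real)"] by simp
    then have "exp (- 2::real) \<le> 1 / 4" by (simp add: exp_minus field_simps)
    then show "2 * (1 + exp (- 2::real)) \<le> 5 / 2" by simp
  qed simp
  finally have "(3 * exp (- (1 / 10))) ^ m \<le> (5 / 2 :: real) ^ m"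
    by (simp add: power_mult_distrib exp_of_nat_mult[symmetric])
  moreover have "3 * exp (- (1 / 10)) > (5 / 2 :: real)"
    using exp_ge_add_one_self[of "- (1 / 10) :: real"] by simp
  ultimately show False
    using m power_strict_mono[of "5 / 2 :: real" "3 * exp (- (1 / 10))" m] by simp
qed

subsection \<open>Singular functions of the anchored box kernel\<close>

lemma
  fixes f :: "'n::finite \<Rightarrow> real \<Rightarrow> real"
  assumes "\<And>i. integrable lborel (f i)"
  shows integrable_lborel_vec_prod: "integrable lborel (\<lambda>y::real^'n. \<Prod>i\<in>UNIV. f i (y $ i))"
    and integral_lborel_vec_prod:
      "(\<integral>y. (\<Prod>i\<in>UNIV. f i ((y::real^'n) $ i)) \<partial>lborel) = (\<Prod>i\<in>UNIV. integral\<^sup>L lborel (f i))"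
proof -
  \<comment> \<open>By \<open>lborel_eq\<close>, \<open>lborel\<close> is the image of a product of
    one-dimensional measures indexed by \<open>Basis\<close>; coordinates are therefore reindexed
    along \<open>axis i 1\<close> before the product theorems apply.\<close>
  interpret product_sigma_finite "\<lambda>_::real^'n. lborel :: real measure"
    by standard
  have bij: "bij_betw (\<lambda>i. axis i (1::real) :: real^'n) UNIV Basis"
    by (auto simp: bij_betw_def inj_on_def axis_eq_axis Basis_vec_def)
  have reindex: "(\<Prod>b\<in>Basis. h (axis_index (b :: real^'n)) b) = (\<Prod>i\<in>UNIV. h i (axis i 1))"
    for h :: "'n \<Rightarrow> real^'n \<Rightarrow> real"
    by (subst prod.reindex_bij_betw[OF bij, symmetric]) simp
  have comp: "(\<Sum>b\<in>Basis. x b *\<^sub>R b) $ i = x (axis i 1)" for x :: "real^'n \<Rightarrow> real" and i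
  proof -
    have "(\<Sum>b\<in>Basis. x b *\<^sub>R b) $ i = (\<Sum>b\<in>Basis. x b *\<^sub>R b) \<bullet> axis i 1"
      by (simp add: inner_axis)
    also have "\<dots> = x (axis i 1)"
      by (subst inner_sum_left_Basis) auto
    finally show ?thesis .
  qed
  have [measurable]: "f i \<in> borel_measurable borel" for i
    using borel_measurable_integrable[OF assms[of i]] by simp
  have [measurable]: "(\<lambda>y::real^'n. y $ i) \<in> borel_measurable borel" for i
    by (intro borel_measurable_continuous_onI continuous_intros)
  have meas: "(\<lambda>y::real^'n. \<Prod>i\<in>UNIV. f i (y $ i)) \<in> borel_measurable borel"
    by measurable
  have eq: "(\<Prod>i\<in>UNIV. f i ((\<Sum>b\<in>Basis. x b *\<^sub>R b) $ i))
      = (\<Prod>b\<in>Basis. f (axis_index (b :: real^'n)) (x b))" for x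
    unfolding comp by (rule reindex[of "\<lambda>i b. f i (x b)", symmetric])
  have int: "integrable (\<Pi>\<^sub>M b\<in>Basis. lborel) (\<lambda>x. \<Prod>b\<in>Basis. f (axis_index (b :: real^'n)) (x b))"
    using assms by (intro product_integrable_prod) auto
  have val: "(\<integral>x. (\<Prod>b\<in>Basis. f (axis_index (b :: real^'n)) (x b)) \<partial>(\<Pi>\<^sub>M b\<in>Basis. lborel))
      = (\<Prod>i\<in>UNIV. integral\<^sup>L lborel (f i))"
    using assms by (subst product_integral_prod) (auto simp: reindex[of "\<lambda>i b. integral\<^sup>L lborel (f i)"])
  have emb: "(\<lambda>x. \<Sum>b\<in>Basis. x b *\<^sub>R b) \<in> measurable (\<Pi>\<^sub>M b\<in>(Basis :: (real^'n) set). lborel) borel"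
    by measurable
  show "integrable lborel (\<lambda>y::real^'n. \<Prod>i\<in>UNIV. f i (y $ i))"
    by (subst lborel_eq, subst integrable_distr_eq[OF emb meas]) (unfold eq, rule int)
  show "(\<integral>y. (\<Prod>i\<in>UNIV. f i ((y::real^'n) $ i)) \<partial>lborel) = (\<Prod>i\<in>UNIV. integral\<^sup>L lborel (f i))"
    by (subst lborel_eq, subst integral_distr[OF emb meas]) (unfold eq, rule val)
qed

text \<open>The uniform probability measure on the cube. It restricts \<open>lborel\<close>, for
  which the product formula is available; on Borel sets it agrees with the \<open>lebesgue\<close>
  measure used in \<open>anchored_weight\<close>.\<close>

definition cube_measure :: "(real^'n) measure" where
  "cube_measure = restrict_space lborel (cbox 0 One)"

lemma space_cube_measure: "space cube_measure = cbox 0 (One :: real^'n)"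
  by (simp add: cube_measure_def space_restrict_space)

lemma measure_cube_measure: "measure cube_measure (space cube_measure :: (real^'n) set) = 1"
  unfolding space_cube_measure unfolding cube_measure_def
  by (subst measure_restrict_space) (auto simp: content_cbox_if)

lemma finite_measure_cube_measure: "finite_measure (cube_measure :: (real^'n) measure)"
  by (rule finite_measureI)
    (simp add: space_cube_measure, simp add: cube_measure_def emeasure_restrict_space emeasure_lborel_cbox_eq)

lemma mem_unit_cube_iff: "y \<in> cbox 0 One \<longleftrightarrow> (\<forall>i. 0 \<le> y $ i \<and> y $ i \<le> 1)" for y :: "real^'n"
proof -
  have "(One :: real^'n) $ i = 1" for i
    using inner_axis[of "One :: real^'n" i 1] inner_sum_Basis[of "axis i (1::real)"]
    by (simp add: inner_commute)
  then show ?thesis by (simp add: mem_box_cart)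
qed

lemma
  fixes f :: "'n::finite \<Rightarrow> real \<Rightarrow> real"
  assumes "\<And>i. integrable lborel (\<lambda>t. f i t * indicator {0..1} t)"
  shows integrable_cube_prod: "integrable cube_measure (\<lambda>y::real^'n. \<Prod>i\<in>UNIV. f i (y $ i))"
    and integral_cube_prod: "(\<integral>y. (\<Prod>i\<in>UNIV. f i ((y::real^'n) $ i)) \<partial>cube_measure)
      = (\<Prod>i\<in>UNIV. \<integral>t. f i t * indicator {0..1} t \<partial>lborel)"
proof -
  \<comment> \<open>The indicator of the cube factors over the coordinates, which reduces the claim
    to the whole space.\<close>
  have ind: "indicator (cbox 0 One) y *\<^sub>R (\<Prod>i\<in>UNIV. f i (y $ i))
      = (\<Prod>i\<in>UNIV. f i (y $ i) * indicator {0..1} (y $ i))" for y :: "real^'n"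
  proof (cases "y \<in> cbox 0 One")
    case True
    then have "indicator {0..1} (y $ i) = (1::real)" for i by (simp add: mem_unit_cube_iff)
    then show ?thesis using True by simp
  next
    case False
    then obtain i where "y $ i \<notin> {0..1}" by (auto simp: mem_unit_cube_iff)
    then have "(\<Prod>i\<in>UNIV. f i (y $ i) * indicator {0..1} (y $ i)) = 0"
      by (intro prod_zero bexI[of _ i]) auto
    then show ?thesis using False by simp
  qed
  show "integrable cube_measure (\<lambda>y::real^'n. \<Prod>i\<in>UNIV. f i (y $ i))"
    unfolding cube_measure_def
    by (subst integrable_restrict_space, simp) (unfold ind, rule integrable_lborel_vec_prod, rule assms)
  show "(\<integral>y. (\<Prod>i\<in>UNIV. f i ((y::real^'n) $ i)) \<partial>cube_measure)
      = (\<Prod>i\<in>UNIV. \<integral>t. f i t * indicator {0..1} t \<partial>lborel)"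
    unfolding cube_measure_def
    by (subst integral_restrict_space, simp) (unfold ind, rule integral_lborel_vec_prod, rule assms)
qed

section \<open>Sines and cosines of half-integer frequency in one dimension\<close>

definition freq :: "nat \<Rightarrow> real" where
  "freq k = (real k - 1 / 2) * pi"

lemma freq_pos: "k \<ge> 1 \<Longrightarrow> freq k > 0"
  by (simp add: freq_def)

text \<open>This is why the frequencies are half-integer multiples of \<open>pi\<close>: the
  boundary term at 1 disappears when the sine is integrated over \<open>[p, 1]\<close>.\<close>

lemma cos_freq: "cos (freq k) = 0"
proof -
  have "freq k = pi * real k - pi / 2" by (simp add: freq_def algebra_simps)
  then show ?thesis by (simp add: cos_diff)
qed

text \<open>Both orthonormality relations reduce to this integral, because sums and differences of
  two frequencies are integer multiples of \<open>pi\<close>.\<close>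

lemma integral_cos_pi:
  fixes n :: int
  shows "(\<integral>t. cos (of_int n * pi * t) * indicator {0..1} t \<partial>lborel) = (if n = 0 then 1 else 0)"
proof (cases "n = 0")
  case False
  have "(\<integral>t. cos (of_int n * pi * t) * indicator {0..1} t \<partial>lborel)
     = sin (of_int n * pi * 1) / (of_int n * pi) - sin (of_int n * pi * 0) / (of_int n * pi)"
    using False by (intro integral_FTC_Icc_real) (auto intro!: derivative_eq_intros simp: field_simps)
  also have "sin (of_int n * pi * 1) = 0" by (simp add: sin_zero_iff_int2)
  finally show ?thesis using False by simp
qed simp

lemma integrable_cos_pi: "integrable lborel (\<lambda>t. cos (of_int n * pi * t) * indicator {0..1} t)"
  by (intro borel_integrable_atLeastAtMost) auto

definition sin_basis :: "nat \<Rightarrow> real \<Rightarrow> real" where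
  "sin_basis k t = sqrt 2 * sin (freq k * t)"

definition cos_basis :: "nat \<Rightarrow> real \<Rightarrow> real" where
  "cos_basis k t = sqrt 2 * cos (freq k * t)"

lemma sin_basis_mult:
  "sin_basis k t * sin_basis l t =
     cos (of_int (int k - int l) * pi * t) - cos (of_int (int k + int l - 1) * pi * t)"
proof -
  have "sin_basis k t * sin_basis l t = 2 * (sin (freq k * t) * sin (freq l * t))"
    by (simp add: sin_basis_def)
  also have "\<dots> = cos (freq k * t - freq l * t) - cos (freq k * t + freq l * t)"
    by (simp add: cos_diff cos_add)
  finally show ?thesis by (simp add: freq_def algebra_simps)
qed

lemma cos_basis_mult:
  "cos_basis k t * cos_basis l t =
     cos (of_int (int k - int l) * pi * t) + cos (of_int (int k + int l - 1) * pi * t)"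
proof -
  have "cos_basis k t * cos_basis l t = 2 * (cos (freq k * t) * cos (freq l * t))"
    by (simp add: cos_basis_def)
  also have "\<dots> = cos (freq k * t - freq l * t) + cos (freq k * t + freq l * t)"
    by (simp add: cos_diff cos_add)
  finally show ?thesis by (simp add: freq_def algebra_simps)
qed

text \<open>Indices from 1 on keep \<open>k + l - 1\<close> positive, so only the term with
  \<open>k - l\<close> can survive; the same holds for the cosines.\<close>

lemma sin_basis_orthonormal:
  assumes "k \<ge> 1" "l \<ge> 1"
  shows "(\<integral>t. (sin_basis k t * sin_basis l t) * indicator {0..1} t \<partial>lborel) = (if k = l then 1 else 0)"
  unfolding sin_basis_mult left_diff_distrib
  using assms integrable_cos_pi by (subst Bochner_Integration.integral_diff) (auto simp del: of_int_diff of_int_add simp: integral_cos_pi)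

lemma cos_basis_orthonormal:
  assumes "k \<ge> 1" "l \<ge> 1"
  shows "(\<integral>t. (cos_basis k t * cos_basis l t) * indicator {0..1} t \<partial>lborel) = (if k = l then 1 else 0)"
  unfolding cos_basis_mult distrib_right
  using assms integrable_cos_pi by (subst Bochner_Integration.integral_add) (auto simp del: of_int_diff of_int_add simp: integral_cos_pi)

text \<open>The singular value relation in one dimension: the kernel sends a sine to the matching
  cosine, divided by the frequency.\<close>

lemma integral_sin_basis_tail:
  assumes "k \<ge> 1" "0 \<le> p" "p \<le> 1"
  shows "(\<integral>t. (indicator {p..} t * sin_basis k t) * indicator {0..1} t \<partial>lborel) = cos_basis k p / freq k"
proof -
  have "(\<integral>t. (indicator {p..} t * sin_basis k t) * indicator {0..1} t \<partial>lborel)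
     = (\<integral>t. sin_basis k t * indicator {p..1} t \<partial>lborel)"
    using assms by (intro Bochner_Integration.integral_cong) (auto simp: indicator_def)
  also have "\<dots> = - (sqrt 2 * cos (freq k * 1) / freq k) - - (sqrt 2 * cos (freq k * p) / freq k)"
    unfolding sin_basis_def using assms freq_pos[of k]
    by (intro integral_FTC_Icc_real) (auto intro!: derivative_eq_intros simp: field_simps)
  finally show ?thesis by (simp add: cos_freq cos_basis_def)
qed

lemma integrable_sin_basis_tail:
  "integrable lborel (\<lambda>t. (indicator {p..} t * sin_basis k t) * indicator {0..1} t)"
proof -
  have "integrable lborel (\<lambda>t. sin_basis k t * indicator {max p 0..1} t)"
    unfolding sin_basis_def by (intro borel_integrable_atLeastAtMost) auto
  also have "(\<lambda>t. sin_basis k t * indicator {max p 0..1} t) = (\<lambda>t. (indicator {p..} t * sin_basis k t) * indicator {0..1} t)"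
    by (auto simp: indicator_def fun_eq_iff)
  finally show ?thesis .
qed

section \<open>Tensor products of the one-dimensional systems\<close>

definition sin_tensor :: "('n::finite \<Rightarrow> nat) \<Rightarrow> real^'n \<Rightarrow> real" where
  "sin_tensor k y = (\<Prod>i\<in>UNIV. sin_basis (k i) (y $ i))"

definition cos_tensor :: "('n::finite \<Rightarrow> nat) \<Rightarrow> real^'n \<Rightarrow> real" where
  "cos_tensor k y = (\<Prod>i\<in>UNIV. cos_basis (k i) (y $ i))"

text \<open>The kernel \<open>[p \<le> y]\<close>, written as a product over coordinates so that
  integrals against tensors factor.\<close>

definition orthant :: "real^'n \<Rightarrow> real^'n \<Rightarrow> real" where
  "orthant p y = (\<Prod>i\<in>UNIV. indicator {p $ i..} (y $ i))"

lemma prod_delta_fun: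
  fixes k l :: "'n::finite \<Rightarrow> 'b"
  shows "(\<Prod>i\<in>UNIV. if k i = l i then 1 else 0) = (if k = l then 1 else (0::real))"
proof (cases "k = l")
  case False
  then obtain i where "k i \<noteq> l i" by auto
  then have "(\<Prod>i\<in>UNIV. if k i = l i then 1 else (0::real)) = 0"
    by (intro prod_zero) auto
  then show ?thesis using False by simp
qed simp

lemma
  fixes k l :: "'n::finite \<Rightarrow> nat"
  shows integrable_sin_tensor: "integrable cube_measure (\<lambda>y. sin_tensor k y * sin_tensor l y)"
    and sin_tensor_orthonormal: "(\<And>i. k i \<ge> 1) \<Longrightarrow> (\<And>i. l i \<ge> 1) \<Longrightarrow>
      (\<integral>y. sin_tensor k y * sin_tensor l y \<partial>cube_measure) = (if k = l then 1 else 0)"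
proof -
  have int: "integrable lborel (\<lambda>t. (sin_basis (k i) t * sin_basis (l i) t) * indicator {0..1} t)" for i
    unfolding sin_basis_def by (intro borel_integrable_atLeastAtMost) auto
  show "integrable cube_measure (\<lambda>y. sin_tensor k y * sin_tensor l y)"
    unfolding sin_tensor_def prod.distrib[symmetric] by (rule integrable_cube_prod[OF int])
  show "(\<integral>y. sin_tensor k y * sin_tensor l y \<partial>cube_measure) = (if k = l then 1 else 0)"
    if "\<And>i. k i \<ge> 1" "\<And>i. l i \<ge> 1"
    unfolding sin_tensor_def prod.distrib[symmetric] integral_cube_prod[OF int]
    by (subst sin_basis_orthonormal[OF that]) (rule prod_delta_fun)
qed

lemma
  fixes k l :: "'n::finite \<Rightarrow> nat"
  shows integrable_cos_tensor: "integrable cube_measure (\<lambda>y. cos_tensor k y * cos_tensor l y)"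
    and cos_tensor_orthonormal: "(\<And>i. k i \<ge> 1) \<Longrightarrow> (\<And>i. l i \<ge> 1) \<Longrightarrow>
      (\<integral>y. cos_tensor k y * cos_tensor l y \<partial>cube_measure) = (if k = l then 1 else 0)"
proof -
  have int: "integrable lborel (\<lambda>t. (cos_basis (k i) t * cos_basis (l i) t) * indicator {0..1} t)" for i
    unfolding cos_basis_def by (intro borel_integrable_atLeastAtMost) auto
  show "integrable cube_measure (\<lambda>y. cos_tensor k y * cos_tensor l y)"
    unfolding cos_tensor_def prod.distrib[symmetric] by (rule integrable_cube_prod[OF int])
  show "(\<integral>y. cos_tensor k y * cos_tensor l y \<partial>cube_measure) = (if k = l then 1 else 0)"
    if "\<And>i. k i \<ge> 1" "\<And>i. l i \<ge> 1"
    unfolding cos_tensor_def prod.distrib[symmetric] integral_cube_prod[OF int]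
    by (subst cos_basis_orthonormal[OF that]) (rule prod_delta_fun)
qed

lemma
  fixes k :: "'n::finite \<Rightarrow> nat"
  shows integrable_orthant_sin_tensor: "integrable cube_measure (\<lambda>y. orthant p y * sin_tensor k y)"
    and integral_orthant_sin_tensor: "(\<And>i. k i \<ge> 1) \<Longrightarrow> p \<in> cbox 0 One \<Longrightarrow>
      (\<integral>y. orthant p y * sin_tensor k y \<partial>cube_measure) = cos_tensor k p / (\<Prod>i\<in>UNIV. freq (k i))"
proof -
  show "integrable cube_measure (\<lambda>y. orthant p y * sin_tensor k y)"
    unfolding sin_tensor_def orthant_def prod.distrib[symmetric]
    by (rule integrable_cube_prod[OF integrable_sin_basis_tail])
  show "(\<integral>y. orthant p y * sin_tensor k y \<partial>cube_measure) = cos_tensor k p / (\<Prod>i\<in>UNIV. freq (k i))"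
    if "\<And>i. k i \<ge> 1" "p \<in> cbox 0 One"
    unfolding sin_tensor_def orthant_def cos_tensor_def prod.distrib[symmetric]
      integral_cube_prod[OF integrable_sin_basis_tail] prod_dividef[symmetric]
    using that by (intro prod.cong integral_sin_basis_tail) (auto simp: mem_unit_cube_iff)
qed

subsection \<open>Weighted discrepancy as an integral\<close>

lemma orthant_eq_indicator:
  assumes "p \<in> cbox 0 (One :: real^'n)"
  shows "orthant p y = indicator (anchored_box y) p"
proof (cases "p \<in> anchored_box y")
  case True
  then show ?thesis by (auto simp: orthant_def anchored_box_def mem_box_cart)
next
  case False
  then obtain i where "\<not> p $ i \<le> y $ i"
    using assms by (auto simp: anchored_box_def mem_box_cart)
  then have "orthant p y = 0" unfolding orthant_def by (intro prod_zero bexI[of _ i]) auto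
  then show ?thesis using False by simp
qed

text \<open>The cube splits into the level sets of the trace
  \<open>anchored_box y \<inter> P\<close>. A function of the trace is thus a simple function, and
  the weights are the measures of its level sets.\<close>

lemma
  fixes P :: "(real^'n) set" and g :: "(real^'n) set \<Rightarrow> real"
  assumes P: "finite P" "P \<subseteq> cbox 0 One"
  shows integrable_anchored: "integrable cube_measure (\<lambda>y. g (anchored_box y \<inter> P))"
    and sum_anchored_weight: "(\<Sum>F\<in>anchored_boxes P. anchored_weight P F * g F)
      = (\<integral>y. g (anchored_box y \<inter> P) \<partial>cube_measure)"
proof -
  interpret finite_measure "cube_measure :: (real^'n) measure" by (rule finite_measure_cube_measure)
  have finA: "finite (anchored_boxes P)"
    by (rule finite_subset[of _ "Pow P"]) (use P in \<open>auto simp: anchored_boxes_def\<close>)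
  define E where "E F = {y \<in> cbox 0 One. anchored_box y \<inter> P = F}" for F
  have [measurable]: "(\<lambda>y::real^'n. y $ i) \<in> borel_measurable borel" for i
    by (intro borel_measurable_continuous_onI continuous_intros)
  have mE: "E F \<in> sets lborel" for F
  proof (cases "F \<subseteq> P")
    case True
    have up: "{y. p \<in> anchored_box y} \<in> sets lborel" for p :: "real^'n"
      unfolding anchored_box_def mem_box_cart by measurable
    \<comment> \<open>Measurability: the trace equals \<open>F\<close> exactly when each of the
      finitely many points of \<open>P\<close> is in or out of the box as \<open>F\<close>
      prescribes.\<close>
    have "E F = cbox 0 One \<inter> (\<Inter>p\<in>P. if p \<in> F then {y. p \<in> anchored_box y} else - {y. p \<in> anchored_box y})"
      using True by (auto simp: E_def split: if_splits)
    also have "\<dots> \<in> sets lborel"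
    proof (cases "P = {}")
      case False
      then show ?thesis using P up by (intro sets.Int sets.finite_INT) auto
    qed simp
    finally show ?thesis .
  next
    case False
    then have "E F = {}" by (auto simp: E_def)
    then show ?thesis by simp
  qed
  have mE': "E F \<in> sets cube_measure" for F
    using mE[of F] by (auto simp: cube_measure_def sets_restrict_space E_def image_iff intro!: bexI[of _ "E F"])
  have wE: "anchored_weight P F = measure cube_measure (E F)" for F
    using mE[of F] unfolding cube_measure_def anchored_weight_def
    by (subst measure_restrict_space) (auto simp: E_def)
  have eq: "g (anchored_box y \<inter> P) = (\<Sum>F\<in>anchored_boxes P. g F * indicator (E F) y)"
    if "y \<in> space cube_measure" for y
  proof -
    have "(\<Sum>F\<in>anchored_boxes P. g F * indicator (E F) y)
       = (\<Sum>F\<in>anchored_boxes P. if F = anchored_box y \<inter> P then g F else 0)"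
      using that by (intro sum.cong) (auto simp: E_def space_cube_measure)
    moreover have "anchored_box y \<inter> P \<in> anchored_boxes P"
      using that by (auto simp: anchored_boxes_def space_cube_measure)
    ultimately show ?thesis using finA by simp
  qed
  have int: "integrable cube_measure (\<lambda>y. \<Sum>F\<in>anchored_boxes P. g F * indicator (E F) y)"
    using mE' by (intro Bochner_Integration.integrable_sum integrable_mult_right)
       (simp add: emeasure_eq_measure)
  then show "integrable cube_measure (\<lambda>y. g (anchored_box y \<inter> P))"
    by (subst Bochner_Integration.integrable_cong[OF refl eq]) auto
  have "(\<integral>y. g (anchored_box y \<inter> P) \<partial>cube_measure)
      = (\<integral>y. (\<Sum>F\<in>anchored_boxes P. g F * indicator (E F) y) \<partial>cube_measure)"
    by (intro Bochner_Integration.integral_cong refl eq)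
  also have "\<dots> = (\<Sum>F\<in>anchored_boxes P. g F * measure cube_measure (E F))"
    using mE' by (subst Bochner_Integration.integral_sum) (auto simp: emeasure_eq_measure)
  finally show "(\<Sum>F\<in>anchored_boxes P. anchored_weight P F * g F) = (\<integral>y. g (anchored_box y \<inter> P) \<partial>cube_measure)"
    by (simp add: wE mult.commute)
qed

lemma sum_anchored_orthant:
  fixes P :: "(real^'n) set"
  assumes "finite P" "P \<subseteq> cbox 0 One"
  shows "(\<Sum>v\<in>anchored_box y \<inter> P. x v) = (\<Sum>p\<in>P. x p * orthant p y)"
proof -
  have "(\<Sum>p\<in>P. x p * orthant p y) = (\<Sum>p\<in>P. if p \<in> anchored_box y then x p else 0)"
    using assms by (intro sum.cong) (auto simp: orthant_eq_indicator)
  then show ?thesis using assms by (simp add: sum.inter_restrict Int_commute)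
qed

lemma integrable_orthant_sum:
  fixes P :: "(real^'n) set"
  assumes "finite P" "P \<subseteq> cbox 0 One"
  shows "integrable cube_measure (\<lambda>y. (\<Sum>p\<in>P. x p * orthant p y)\<^sup>2)"
  using integrable_anchored[OF assms, of "\<lambda>F. (\<Sum>v\<in>F. x v)\<^sup>2"] by (simp add: sum_anchored_orthant[OF assms])

lemma disc_anchored_ge:
  fixes P :: "(real^'n) set"
  assumes P: "finite P" "P \<subseteq> cbox 0 One" and D: "D \<ge> 0"
    and ge: "\<And>x. (\<And>p. x p \<in> {-1,1}) \<Longrightarrow> D\<^sup>2 \<le> (\<integral>y. (\<Sum>p\<in>P. x p * orthant p y)\<^sup>2 \<partial>cube_measure)"
  shows "D \<le> disc 2 (anchored_weight P) P (anchored_boxes P)"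
proof -
  interpret finite_measure "cube_measure :: (real^'n) measure" by (rule finite_measure_cube_measure)
  have tot: "(\<Sum>F\<in>anchored_boxes P. anchored_weight P F) = 1"
    using sum_anchored_weight[OF P, of "\<lambda>_. 1"] by (simp add: measure_cube_measure)
  have "D \<le> ((1 / (\<Sum>F\<in>anchored_boxes P. anchored_weight P F)) *
        (\<Sum>F\<in>anchored_boxes P. anchored_weight P F * \<bar>\<Sum>v\<in>F. x v\<bar> powr 2)) powr (1 / 2)"
    if x: "x \<in> PiE P (\<lambda>_. {-1, 1::real})" for x
  proof -
    \<comment> \<open>An element of \<open>PiE\<close> is \<open>undefined\<close> outside
      \<open>P\<close>; the value 1 there yields a signing of the whole space without changing the
      sums.\<close>
    define x' where "x' p = (if p \<in> P then x p else 1)" for p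
    have x': "x' p \<in> {-1,1}" for p using x by (auto simp: x'_def PiE_def Pi_def)
    have "(\<Sum>F\<in>anchored_boxes P. anchored_weight P F * \<bar>\<Sum>v\<in>F. x v\<bar> powr 2)
       = (\<Sum>F\<in>anchored_boxes P. anchored_weight P F * (\<Sum>v\<in>F. x v)\<^sup>2)"
      by simp
    also have "\<dots> = (\<integral>y. (\<Sum>p\<in>P. x p * orthant p y)\<^sup>2 \<partial>cube_measure)"
      using sum_anchored_weight[OF P, of "\<lambda>F. (\<Sum>v\<in>F. x v)\<^sup>2"] by (simp add: sum_anchored_orthant[OF P])
    also have "\<dots> = (\<integral>y. (\<Sum>p\<in>P. x' p * orthant p y)\<^sup>2 \<partial>cube_measure)"
      by (simp add: x'_def)
    also have "\<dots> \<ge> D\<^sup>2" using ge x' by blast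
    finally have "D\<^sup>2 powr (1 / 2) \<le> (\<Sum>F\<in>anchored_boxes P. anchored_weight P F * \<bar>\<Sum>v\<in>F. x v\<bar> powr 2) powr (1 / 2)"
      by (intro powr_mono2) auto
    then show ?thesis using D by (simp add: tot powr_half_sqrt)
  qed
  moreover have "finite (PiE P (\<lambda>_. {-1, 1::real}))" using P by (intro finite_PiE) auto
  moreover have "PiE P (\<lambda>_. {-1, 1::real}) \<noteq> {}" by (simp add: PiE_eq_empty_iff)
  ultimately show ?thesis unfolding disc_def by (subst Min_ge_iff) auto
qed

text \<open>Applied to the signing that is constantly 1, this trivial bound turns a large
  discrepancy into a lower bound on the number of points.\<close>

lemma orthant_sum_norm_le_card:
  fixes P :: "(real^'n) set"
  assumes P: "finite P" "P \<subseteq> cbox 0 One"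
  shows "(\<integral>y. (\<Sum>p\<in>P. orthant p y)\<^sup>2 \<partial>cube_measure) \<le> (real (card P))\<^sup>2"
proof -
  interpret finite_measure "cube_measure :: (real^'n) measure" by (rule finite_measure_cube_measure)
  have bound: "(\<Sum>p\<in>P. orthant p y)\<^sup>2 \<le> (real (card P))\<^sup>2" for y
  proof (rule power_mono)
    have "(\<Sum>p\<in>P. orthant p y) \<le> (\<Sum>p\<in>P. 1)"
      using P by (intro sum_mono) (auto simp: orthant_eq_indicator indicator_def)
    then show "(\<Sum>p\<in>P. orthant p y) \<le> real (card P)" by simp
    show "0 \<le> (\<Sum>p\<in>P. orthant p y)"
      by (intro sum_nonneg) (auto simp: orthant_def intro!: prod_nonneg)
  qed
  have "(\<integral>y. (\<Sum>p\<in>P. orthant p y)\<^sup>2 \<partial>(cube_measure :: (real^'n) measure)) \<le> (\<integral>y. (real (card P))\<^sup>2 \<partial>(cube_measure :: (real^'n) measure))"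
    using integrable_orthant_sum[OF P, of "\<lambda>_. 1"] bound by (intro integral_mono) auto
  then show ?thesis by (simp add: measure_cube_measure)
qed

subsection \<open>Hyperbolic crosses and the lower bound\<close>

text \<open>Greedy selection is run on the cosine tensors scaled by \<sigma>, a lower bound for the
  singular values on \<open>H\<close>. The triangular matrix so obtained has a subset of columns on
  which every signing is large, and \<open>P\<close> consists of the corresponding points.\<close>

lemma anchored_point_set_exists:
  fixes H :: "('n::finite \<Rightarrow> nat) set" and \<sigma> :: real
  assumes H: "finite H" "\<And>k i. k \<in> H \<Longrightarrow> k i \<ge> 1"
    and \<sigma>: "\<sigma> > 0" "\<And>k. k \<in> H \<Longrightarrow> \<sigma> * (\<Prod>i\<in>UNIV. freq (k i)) \<le> 1"
    and m: "m > 0" "2 * m \<le> card H"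
  shows "\<exists>P :: (real^'n) set. finite P \<and> P \<subseteq> cbox 0 One \<and> card P \<le> m \<and>
    (\<forall>x. (\<forall>p. x p \<in> {-1, 1}) \<longrightarrow>
      m * (\<sigma>\<^sup>2 * card H / 2) / 80 \<le> (\<integral>y. (\<Sum>p\<in>P. x p * orthant p y)\<^sup>2 \<partial>cube_measure))"
proof -
  define \<phi> where "\<phi> p k = \<sigma> * cos_tensor k p" for p :: "real^'n" and k
  have \<phi>_mult: "\<phi> p k * \<phi> p l = \<sigma>\<^sup>2 * (cos_tensor k p * cos_tensor l p)" for p k l
    by (simp add: \<phi>_def power2_eq_square)
  have int: "integrable cube_measure (\<lambda>p. \<phi> p k * \<phi> p l)" for k l
    unfolding \<phi>_mult by (intro integrable_mult_right integrable_cos_tensor)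
  have orth: "(\<integral>p. \<phi> p k * \<phi> p l \<partial>cube_measure) = (if k = l then \<sigma>\<^sup>2 else 0)" if "k \<in> H" "l \<in> H" for k l
    unfolding \<phi>_mult using H(2) that by (simp add: cos_tensor_orthonormal)
  from greedy_orthonormal_selection[OF finite_measure_cube_measure measure_cube_measure H(1) int orth _ m(2)]
  obtain p g where sel: "\<forall>i<m. p i \<in> space cube_measure"
    "\<forall>i<m. \<forall>j<m. inner_on H (g i) (g j) = (if i = j then 1 else 0)"
    "\<forall>i<m. \<forall>j<i. inner_on H (\<phi> (p j)) (g i) = 0"
    "\<forall>i<m. (inner_on H (\<phi> (p i)) (g i))\<^sup>2 \<ge> \<sigma>\<^sup>2 * card H / 2"
    using \<sigma>(1) by auto
  define R where "R i j = inner_on H (\<phi> (p j)) (g i)" for i j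
  define d where "d = sqrt (\<sigma>\<^sup>2 * card H / 2)"
  have pos: "\<sigma>\<^sup>2 * card H / 2 > 0" using \<sigma> m by simp
  have d: "d > 0" "d\<^sup>2 = \<sigma>\<^sup>2 * card H / 2" using pos by (auto simp: d_def)
  \<comment> \<open>A repeated point would have coefficient zero and nonzero along the same
    direction \<open>g i\<close>.\<close>
  have inj: "inj_on p {..<m}"
  proof (rule linorder_inj_onI)
    fix j i assume "j < i" "j \<in> {..<m}" "i \<in> {..<m}"
    then have "inner_on H (\<phi> (p j)) (g i) = 0" "(inner_on H (\<phi> (p i)) (g i))\<^sup>2 > 0"
      using sel(3,4) pos by (auto intro: less_le_trans)
    then show "p j \<noteq> p i" by auto
  qed auto
  obtain S where S: "S \<subseteq> {..<m}"
    "\<And>x. (\<forall>j. x j \<in> {-1, 1::real}) \<Longrightarrow> (\<Sum>i<m. (\<Sum>j\<in>S. R i j * x j)\<^sup>2) \<ge> m * d\<^sup>2 / 80"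
    using triangular_hereditary_discrepancy[of m d R] sel(3,4) d m(1) unfolding R_def by auto
  have finS: "finite S" using S(1) finite_subset by blast
  have injS: "inj_on p S" using inj S(1) inj_on_subset by blast
  define P where "P = p ` S"
  have P: "finite P" "P \<subseteq> cbox 0 One"
    using finS S(1) sel(1) by (auto simp: P_def space_cube_measure)
  have cardP: "card P \<le> m"
    using card_image[OF injS] card_mono[OF finite_lessThan S(1)] by (simp add: P_def)
  have "m * (\<sigma>\<^sup>2 * card H / 2) / 80 \<le> (\<integral>y. (\<Sum>q\<in>P. x q * orthant q y)\<^sup>2 \<partial>cube_measure)"
    if x: "\<forall>p. x p \<in> {-1, 1}" for x :: "real^'n \<Rightarrow> real"
  proof -
    \<comment> \<open>Damping each coefficient to size \<open>\<sigma>\<close> only decreases the norm, and makes the second moment of \<open>\<phi>\<close> scalar.\<close>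
    define v where "v k = (\<Sum>q\<in>P. x q * \<phi> q k)" for k
    let ?F = "\<lambda>y. \<Sum>q\<in>P. x q * orthant q y"
    have Fs_int: "integrable cube_measure (\<lambda>y. ?F y * sin_tensor k y)" for k
      unfolding sum_distrib_right mult.assoc
      by (intro Bochner_Integration.integrable_sum integrable_mult_right integrable_orthant_sin_tensor)
    have Fs: "(\<integral>y. ?F y * sin_tensor k y \<partial>cube_measure) = (\<Sum>q\<in>P. x q * cos_tensor k q) / (\<Prod>i\<in>UNIV. freq (k i))"
      if "k \<in> H" for k
    proof -
      have "(\<integral>y. ?F y * sin_tensor k y \<partial>cube_measure)
         = (\<Sum>q\<in>P. x q * (\<integral>y. orthant q y * sin_tensor k y \<partial>cube_measure))"
        unfolding sum_distrib_right mult.assoc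
        by (subst Bochner_Integration.integral_sum) (auto intro!: integrable_mult_right integrable_orthant_sin_tensor)
      also have "\<dots> = (\<Sum>q\<in>P. x q * (cos_tensor k q / (\<Prod>i\<in>UNIV. freq (k i))))"
        using P(2) H(2)[OF that] by (intro sum.cong refl) (auto simp: integral_orthant_sin_tensor)
      finally show ?thesis by (simp add: sum_divide_distrib)
    qed
    have v_le: "v k * v k \<le> (\<integral>y. ?F y * sin_tensor k y \<partial>cube_measure)\<^sup>2" if "k \<in> H" for k
    proof -
      let ?c = "\<Sum>q\<in>P. x q * cos_tensor k q" and ?w = "\<Prod>i\<in>UNIV. freq (k i)"
      have w: "?w > 0" using H(2)[OF that] by (intro prod_pos) (auto intro: freq_pos)
      have "v k = \<sigma> * ?c" by (simp add: v_def \<phi>_def sum_distrib_left mult_ac)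
      moreover have "(\<sigma> * ?c)\<^sup>2 \<le> (?c / ?w)\<^sup>2"
      proof -
        have "\<sigma> \<le> 1 / ?w" using \<sigma>(2)[OF that] w by (simp add: field_simps)
        then have "\<sigma>\<^sup>2 \<le> (1 / ?w)\<^sup>2" using \<sigma>(1) by (intro power_mono) auto
        then have "\<sigma>\<^sup>2 * ?c\<^sup>2 \<le> (1 / ?w)\<^sup>2 * ?c\<^sup>2" by (rule mult_right_mono) simp
        then show ?thesis by (simp add: power_mult_distrib power_divide)
      qed
      ultimately show ?thesis by (simp add: Fs[OF that] power2_eq_square)
    qed
    have v_g: "inner_on H v (g i) = (\<Sum>j\<in>S. R i j * x (p j))" for i
    proof -
      have "inner_on H v (g i) = (\<Sum>q\<in>P. x q * inner_on H (\<phi> q) (g i))"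
        unfolding v_def[abs_def] by (rule inner_on_combination_left)
      then show ?thesis
        using injS by (simp add: P_def sum.reindex R_def mult.commute)
    qed
    \<comment> \<open>The chain uses the hereditary bound, Bessel for the directions
      \<open>g i\<close> in \<open>R^H\<close>, the damping, and Bessel for the sine tensors on the
      cube.\<close>
    have "m * (\<sigma>\<^sup>2 * card H / 2) / 80 \<le> (\<Sum>i<m. (\<Sum>j\<in>S. R i j * x (p j))\<^sup>2)"
      using S(2)[of "\<lambda>j. x (p j)"] x d(2) by simp
    also have "\<dots> = (\<Sum>i<m. (inner_on H v (g i))\<^sup>2)" by (simp add: v_g)
    also have "\<dots> \<le> inner_on H v v"
      using sel(2) by (intro Bessel_inner_on H(1)) auto
    also have "\<dots> \<le> (\<Sum>k\<in>H. (\<integral>y. ?F y * sin_tensor k y \<partial>cube_measure)\<^sup>2)"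
      unfolding inner_on_def using v_le by (intro sum_mono)
    also have "\<dots> \<le> (\<integral>y. ?F y * ?F y \<partial>cube_measure)"
      using integrable_orthant_sum[OF P, of x] H
      by (intro Bessel_integral Fs_int integrable_sin_tensor sin_tensor_orthonormal)
        (auto simp: power2_eq_square)
    finally show ?thesis by (simp add: power2_eq_square)
  qed
  then show ?thesis using P cardP by blast
qed

section \<open>Counting lattice points in a hyperbolic cross\<close>

lemma dyadic_interval_unique:
  fixes a b x :: nat
  assumes "2 ^ a \<le> x" "x < 2 ^ Suc a" "2 ^ b \<le> x" "x < 2 ^ Suc b"
  shows "a = b"
proof -
  have "(2::nat) ^ a < 2 ^ Suc b" "(2::nat) ^ b < 2 ^ Suc a" using assms by linarith+
  then have "a < Suc b" "b < Suc a" by (auto simp only: power_strict_increasing_iff)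
  then show ?thesis by simp
qed

text \<open>\<open>H\<close> is a disjoint union of dyadic boxes with exponent vectors
  \<open>e\<close> of sum \<open>t\<close>: each box has \<open>2 ^ t\<close> points, all with
  coordinate product at most \<open>2 ^ (t + CARD('n))\<close>. All exponents but one range freely
  over \<open>{0..q}\<close>, which gives the exact number of boxes.\<close>

lemma hyperbolic_cross_large:
  fixes t :: nat
  shows "\<exists>H :: ('n::finite \<Rightarrow> nat) set. finite H \<and> (\<forall>k\<in>H. \<forall>i. k i \<ge> 1) \<and>
    (\<forall>k\<in>H. (\<Prod>i\<in>UNIV. k i) \<le> 2 ^ (t + CARD('n))) \<and>
    card H = 2 ^ t * (t div CARD('n) + 1) ^ (CARD('n) - 1)"
proof -
  define q where "q = t div CARD('n)"
  obtain i0 :: 'n where True by blast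
  define J where "J = UNIV - {i0}"
  have J: "finite J" "card J = CARD('n) - 1" "i0 \<notin> J" by (auto simp: J_def card_Diff_singleton)
  \<comment> \<open>The exponent at \<open>i0\<close> fills the sum up to \<open>t\<close>. The
    choice of \<open>q\<close> keeps \<open>sum e J\<close> at most \<open>t\<close>, so the
    subtraction of naturals is exact.\<close>
  define ext where "ext e = e(i0 := t - sum e J)" for e :: "'n \<Rightarrow> nat"
  define E where "E = ext ` PiE J (\<lambda>_. {0..q})"
  have inj: "inj_on ext (PiE J (\<lambda>_. {0..q}))"
  proof (rule inj_onI)
    fix e f assume *: "e \<in> PiE J (\<lambda>_. {0..q})" "f \<in> PiE J (\<lambda>_. {0..q})" "ext e = ext f"
    show "e = f"
    proof (rule PiE_ext[OF *(1,2)])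
      fix i assume "i \<in> J"
      then show "e i = f i" using fun_cong[OF *(3), of i] J(3) by (auto simp: ext_def split: if_splits)
    qed
  qed
  have cardE: "card E = (q + 1) ^ (CARD('n) - 1)"
    unfolding E_def card_image[OF inj] using J by (simp add: card_PiE)
  have finE: "finite E" unfolding E_def using J by (intro finite_imageI finite_PiE) auto
  have sumE: "(\<Sum>i\<in>UNIV. e i) = t" if eE: "e \<in> E" for e
  proof -
    obtain f where f: "f \<in> PiE J (\<lambda>_. {0..q})" "e = ext f" using eE unfolding E_def by blast
    have "sum f J \<le> (\<Sum>i\<in>J. q)" using f(1) by (intro sum_mono) auto
    also have "\<dots> \<le> CARD('n) * q" by (simp add: J(2))
    also have "\<dots> \<le> t" by (simp add: q_def)
    finally have le: "sum f J \<le> t" .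
    have "(\<Sum>i\<in>UNIV. e i) = e i0 + sum e J" unfolding J_def by (rule sum.remove) auto
    also have "sum e J = sum f J" using J(3) by (intro sum.cong) (auto simp: f(2) ext_def)
    also have "e i0 = t - sum f J" by (simp add: f(2) ext_def)
    finally show ?thesis using le by simp
  qed
  define D where "D e = PiE UNIV (\<lambda>i. {2 ^ e i..<2 ^ Suc (e i) :: nat})" for e :: "'n \<Rightarrow> nat"
  have finD: "finite (D e)" for e unfolding D_def by (intro finite_PiE) auto
  have cardD: "card (D e) = 2 ^ t" if "e \<in> E" for e
    using sumE[OF that] by (simp add: D_def card_PiE power_sum[symmetric])
  have disj: "D e \<inter> D f = {}" if "e \<noteq> f" for e f
  proof (rule ccontr)
    assume "D e \<inter> D f \<noteq> {}"
    then obtain k where "k \<in> D e" "k \<in> D f" by blast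
    then have "e i = f i" for i
      by (intro dyadic_interval_unique[of "e i" "k i" "f i"]) (auto simp: D_def PiE_def Pi_def simp del: power_Suc)
    then show False using that by auto
  qed
  have "card (\<Union>e\<in>E. D e) = (\<Sum>e\<in>E. card (D e))"
    using finE finD disj by (intro card_UN_disjoint) auto
  then have "card (\<Union>e\<in>E. D e) = 2 ^ t * (q + 1) ^ (CARD('n) - 1)"
    using cardD cardE by simp
  moreover have "finite (\<Union>e\<in>E. D e)" using finE finD by auto
  moreover have "k i \<ge> 1" if kH: "k \<in> (\<Union>e\<in>E. D e)" for k i
  proof -
    obtain e where "2 ^ e i \<le> k i" using kH by (auto simp: D_def PiE_def Pi_def)
    then show ?thesis using one_le_power[of "2::nat" "e i"] by linarith
  qed
  moreover have "(\<Prod>i\<in>UNIV. k i) \<le> 2 ^ (t + CARD('n))" if kH: "k \<in> (\<Union>e\<in>E. D e)" for k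
  proof -
    obtain e where e: "e \<in> E" "k \<in> D e" using kH by blast
    have "k i \<le> 2 ^ Suc (e i)" for i
      using e(2) by (auto simp: D_def PiE_def Pi_def simp del: power_Suc intro: less_imp_le)
    then have "(\<Prod>i\<in>UNIV. k i) \<le> (\<Prod>i\<in>UNIV. 2 ^ Suc (e i))" by (intro prod_mono) auto
    also have "\<dots> = 2 ^ (\<Sum>i\<in>UNIV. Suc (e i))" by (rule power_sum[symmetric])
    also have "(\<Sum>i\<in>UNIV. Suc (e i)) = t + CARD('n)"
      using sumE[OF e(1)] by (simp add: sum.distrib Suc_eq_plus1 del: One_nat_def add_Suc_right)
    finally show ?thesis .
  qed
  ultimately show ?thesis unfolding q_def by (intro exI[of _ "\<Union>e\<in>E. D e"]) blast
qed

section \<open>Choice of parameters, and point sets of unbounded size\<close>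

theorem theorem7p1:
  assumes "CARD('n::finite) \<ge> 2"
  shows "\<exists>c>0. infinite {n::nat. \<exists>P :: (real^'n) set.
            finite P \<and> card P = n \<and> P \<subseteq> cbox 0 One \<and>
            disc 2 (anchored_weight P) P (anchored_boxes P)
              \<ge> c * ln (real n) ^ (CARD('n) - 1)}"
proof -
  define d where "d = CARD('n)"
  have d: "d \<ge> 2" using assms by (simp add: d_def)
  \<comment> \<open>The factor \<open>(2 * pi) ^ d\<close> is what remains of
    \<open>1 / \<sigma>\<close> after cancelling \<open>2 ^ t\<close>; 18 is the least integer whose
    square is at least 320, the denominator of the squared bound.\<close>
  define C where "C = 18 * (2 * pi) ^ d"
  have C: "C > 0" by (simp add: C_def)
  define c where "c = 1 / (C * real (d * d) ^ (d - 1))"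
  have c: "c > 0" using C d by (simp add: c_def)
  \<comment> \<open>The lower bound on \<open>card P\<close> is carried along because it later
    yields infinitely many cardinalities.\<close>
  have main: "\<exists>P :: (real^'n) set. finite P \<and> P \<subseteq> cbox 0 One \<and> real (t div d + 1) ^ (d - 1) / C \<le> card P \<and>
      c * ln (real (card P)) ^ (d - 1) \<le> disc 2 (anchored_weight P) P (anchored_boxes P)"
    if t: "t \<ge> 1" for t
  proof -
    define q where "q = t div d"
    obtain H :: "('n \<Rightarrow> nat) set" where H: "finite H" "\<And>k i. k \<in> H \<Longrightarrow> k i \<ge> 1"
      "\<And>k. k \<in> H \<Longrightarrow> (\<Prod>i\<in>UNIV. k i) \<le> 2 ^ (t + d)" and cardH: "card H = 2 ^ t * (q + 1) ^ (d - 1)"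
      using hyperbolic_cross_large[where 'n = 'n, of t] unfolding d_def q_def by blast
    \<comment> \<open>Exactly half of \<open>card H\<close>, the most that greedy selection allows;
      this needs \<open>t \<ge> 1\<close>.\<close>
    define m where "m = 2 ^ (t - 1) * (q + 1) ^ (d - 1)"
    have m: "m > 0" "2 * m = card H" using t by (cases t; simp add: m_def cardH)+
    define \<sigma> where "\<sigma> = 1 / (pi ^ d * 2 ^ (t + d))"
    have \<sigma>: "\<sigma> > 0" by (simp add: \<sigma>_def)
    have freq_le: "\<sigma> * (\<Prod>i\<in>UNIV. freq (k i)) \<le> 1" if "k \<in> H" for k
    proof -
      have "(\<Prod>i\<in>UNIV. freq (k i)) \<le> (\<Prod>i\<in>UNIV. real (k i) * pi)"
        using freq_pos[OF H(2)[OF that]] by (intro prod_mono) (auto simp: freq_def less_imp_le mult_right_mono)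
      also have "\<dots> = real (\<Prod>i\<in>UNIV. k i) * pi ^ d" by (simp add: prod.distrib d_def)
      also have "\<dots> \<le> 2 ^ (t + d) * pi ^ d"
        using of_nat_mono[OF H(3)[OF that], where 'a = real] by (intro mult_right_mono) simp_all
      finally show ?thesis by (simp add: \<sigma>_def field_simps)
    qed
    have "\<exists>P :: (real^'n) set. finite P \<and> P \<subseteq> cbox 0 One \<and> card P \<le> m \<and>
      (\<forall>x. (\<forall>p. x p \<in> {-1, 1}) \<longrightarrow>
        m * (\<sigma>\<^sup>2 * card H / 2) / 80 \<le> (\<integral>y. (\<Sum>p\<in>P. x p * orthant p y)\<^sup>2 \<partial>cube_measure))"
      using H(1) \<sigma> m by (intro anchored_point_set_exists) (auto simp: H(2)[unfolded One_nat_def] freq_le)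
    then obtain P :: "(real^'n) set" where P: "finite P" "P \<subseteq> cbox 0 One" "card P \<le> m"
      and low: "\<And>x. (\<forall>p. x p \<in> {-1, 1}) \<Longrightarrow>
        m * (\<sigma>\<^sup>2 * card H / 2) / 80 \<le> (\<integral>y. (\<Sum>p\<in>P. x p * orthant p y)\<^sup>2 \<partial>cube_measure)"
      by blast
    define D where "D = real (q + 1) ^ (d - 1) / C"
    have D: "D > 0" using C by (simp add: D_def)
    have D_eq: "D = real (card H) * \<sigma> / 18"
      by (simp add: D_def C_def cardH \<sigma>_def power_add power_mult_distrib field_simps)
    have "D\<^sup>2 = real (card H) ^ 2 * \<sigma>\<^sup>2 / 324"
      unfolding D_eq by (simp add: power_mult_distrib power_divide)
    also have "\<dots> \<le> real (card H) ^ 2 * \<sigma>\<^sup>2 / 320" by (intro divide_left_mono) auto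
    also have "\<dots> = m * (\<sigma>\<^sup>2 * card H / 2) / 80"
      by (simp add: m(2)[symmetric] power2_eq_square)
    finally have D2: "D\<^sup>2 \<le> m * (\<sigma>\<^sup>2 * card H / 2) / 80" .
    have disc: "D \<le> disc 2 (anchored_weight P) P (anchored_boxes P)"
    proof (rule disc_anchored_ge[OF P(1,2)])
      show "0 \<le> D" using D by simp
      show "D\<^sup>2 \<le> (\<integral>y. (\<Sum>p\<in>P. x p * orthant p y)\<^sup>2 \<partial>cube_measure)"
        if "\<And>p. x p \<in> {-1, 1}" for x
        using D2 low[of x] that by (blast intro: order_trans)
    qed
    \<comment> \<open>The signing constantly 1 is compared with the trivial upper bound for its
      norm.\<close>
    have "D\<^sup>2 \<le> (real (card P))\<^sup>2"
      using order_trans[OF order_trans[OF D2 low[of "\<lambda>_. 1"]]] orthant_sum_norm_le_card[OF P(1,2)] by simp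
    then have cardP: "D \<le> card P" by (rule power2_le_imp_le) simp
    then have n1: "card P \<ge> 1" using D by (cases "card P") auto
    \<comment> \<open>Only an upper bound on the size of \<open>P\<close> matters:
      \<open>card P\<close> is at most \<open>card H\<close>, hence at most
      \<open>2 ^ (t * d)\<close>, and \<open>t\<close> is at most \<open>d * (q + 1)\<close>. The
      constant \<open>c\<close> absorbs the factor \<open>d * d\<close>.\<close>
    have ln_le: "ln (real (card P)) \<le> real (d * d) * real (q + 1)"
    proof -
      have "q + 1 \<le> 2 ^ t"
      proof -
        have "q \<le> t" by (simp add: q_def)
        then show ?thesis using less_exp[of t] by linarith
      qed
      then have "(q + 1) ^ (d - 1) \<le> (2 ^ t) ^ (d - 1)" by (rule power_mono) simp
      then have "card H \<le> 2 ^ t * (2 ^ t) ^ (d - 1)" unfolding cardH by (rule mult_left_mono) simp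
      also have "\<dots> = (2 ^ t) ^ d" using d by (cases d) auto
      also have "\<dots> = 2 ^ (t * d)" by (simp add: power_mult)
      finally have "card P \<le> 2 ^ (t * d)" using P(3) m(2) by linarith
      then have "real (card P) \<le> 2 ^ (t * d)" using of_nat_mono[where 'a = real] by fastforce
      then have "ln (real (card P)) \<le> ln (2 ^ (t * d))" using n1 by (subst ln_le_cancel_iff) auto
      also have "\<dots> = real (t * d) * ln 2" by (simp add: ln_realpow)
      also have "\<dots> \<le> real (t * d) * 1" using ln_2_less_1 by (intro mult_left_mono) auto
      also have "\<dots> \<le> real (d * (q + 1) * d)"
      proof -
        have "t \<le> d * (q + 1)"
          using d dividend_less_times_div[of d t] unfolding q_def by (simp add: less_imp_le)
        then have "t * d \<le> d * (q + 1) * d" by (rule mult_right_mono) simp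
        then show ?thesis by (metis mult.right_neutral of_nat_mono)
      qed
      finally show ?thesis by (simp add: algebra_simps)
    qed
    have "c * ln (real (card P)) ^ (d - 1) \<le> c * (real (d * d) * real (q + 1)) ^ (d - 1)"
      using c n1 ln_le by (intro mult_left_mono power_mono) auto
    also have "\<dots> = D" using C d by (simp add: c_def D_def power_mult_distrib)
    finally show ?thesis using P(1,2) cardP disc unfolding D_def q_def by (intro exI[of _ P]) auto
  qed
  have "\<exists>n>N. n \<in> {n::nat. \<exists>P :: (real^'n) set.
            finite P \<and> card P = n \<and> P \<subseteq> cbox 0 One \<and>
            disc 2 (anchored_weight P) P (anchored_boxes P) \<ge> c * ln (real n) ^ (d - 1)}" for N
  proof -
    \<comment> \<open>With \<open>t = d * r\<close> the quotient \<open>t div d\<close> is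
      \<open>r\<close>, and \<open>d - 1 \<ge> 1\<close> gives \<open>card P\<close> at least
      \<open>r / C\<close>, which exceeds \<open>N\<close>. Adding 1 makes this strict and keeps
      \<open>t\<close> positive.\<close>
    define r where "r = nat \<lceil>C * real N\<rceil> + 1"
    have r: "real r > C * real N" unfolding r_def by linarith
    have "d * r \<ge> 1" using d by (simp add: r_def)
    from main[OF this] obtain P :: "(real^'n) set" where P: "finite P" "P \<subseteq> cbox 0 One"
      "real (d * r div d + 1) ^ (d - 1) / C \<le> card P"
      "c * ln (real (card P)) ^ (d - 1) \<le> disc 2 (anchored_weight P) P (anchored_boxes P)" by blast
    have "real N < real r / C" using r C by (simp add: field_simps)
    also have "\<dots> \<le> real (r + 1) ^ (d - 1) / C"
      using C d self_le_power[of "real (r + 1)" "d - 1"] by (intro divide_right_mono) auto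
    also have "\<dots> \<le> card P" using P(3) d by simp
    finally show ?thesis using P by auto
  qed
  then show ?thesis using c unfolding d_def infinite_nat_iff_unbounded by blast
qed

end
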